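(* For every two infinite compact spaces $K$ and $L$, the space $C_p(K\times L)$ admits $(c_0)_p$ as a quotient.
   Context: All compact spaces are Hausdorff. $C_p(X)$ is the space of continuous real-valued functions on $X$ with the pointwise topology (inherited from the product $\mathbb{R}^X$). $(c_0)_p$ is the space $\{x\in\mathbb{R}^\omega\colon\lim_{n\to\infty}x(n)=0\}$ with the product topology inherited from $\mathbb{R}^\omega$. A topological vector space $E$ admits $F$ as a quotient if there is a closed linear subspace $E_0\subseteq E$ such that the quotient topological vector space $E/E_0$ is (linearly homeomorphically) isomorphic to $F$. *)

theory Defs
  imports "HOL-Analysis.Analysis"
begin

section \<open>Real topological vector spaces with explicit carrier\<close>

text \<open>The underlying set is the topological space of the topology component. An explicit carrier is
  used, rather than a type class, because function spaces over the points of an arbitrary topology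
  and coset spaces are not types.\<close>

record 'a tvs =
  tvs_top :: "'a topology"
  tvs_zero :: "'a"
  tvs_add :: "'a \<Rightarrow> 'a \<Rightarrow> 'a"
  tvs_scale :: "real \<Rightarrow> 'a \<Rightarrow> 'a"

abbreviation tvs_carrier :: "('a, 'b) tvs_scheme \<Rightarrow> 'a set"
  where "tvs_carrier E \<equiv> topspace (tvs_top E)"

locale real_tvs =
  fixes E :: "('a, 'b) tvs_scheme"
  assumes zero_closed: "tvs_zero E \<in> tvs_carrier E"
    and add_closed: "\<lbrakk>x \<in> tvs_carrier E; y \<in> tvs_carrier E\<rbrakk> \<Longrightarrow> tvs_add E x y \<in> tvs_carrier E"
    and scale_closed: "x \<in> tvs_carrier E \<Longrightarrow> tvs_scale E c x \<in> tvs_carrier E"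
    and add_assoc: "\<lbrakk>x \<in> tvs_carrier E; y \<in> tvs_carrier E; z \<in> tvs_carrier E\<rbrakk>
        \<Longrightarrow> tvs_add E (tvs_add E x y) z = tvs_add E x (tvs_add E y z)"
    and add_commute: "\<lbrakk>x \<in> tvs_carrier E; y \<in> tvs_carrier E\<rbrakk> \<Longrightarrow> tvs_add E x y = tvs_add E y x"
    and add_zero: "x \<in> tvs_carrier E \<Longrightarrow> tvs_add E (tvs_zero E) x = x"
    and add_inverse: "x \<in> tvs_carrier E \<Longrightarrow> tvs_add E x (tvs_scale E (- 1) x) = tvs_zero E"
    and scale_one: "x \<in> tvs_carrier E \<Longrightarrow> tvs_scale E 1 x = x"
    and scale_scale: "x \<in> tvs_carrier E \<Longrightarrow> tvs_scale E a (tvs_scale E b x) = tvs_scale E (a * b) x"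
    and scale_add_left: "x \<in> tvs_carrier E
        \<Longrightarrow> tvs_scale E (a + b) x = tvs_add E (tvs_scale E a x) (tvs_scale E b x)"
    and scale_add_right: "\<lbrakk>x \<in> tvs_carrier E; y \<in> tvs_carrier E\<rbrakk>
        \<Longrightarrow> tvs_scale E a (tvs_add E x y) = tvs_add E (tvs_scale E a x) (tvs_scale E a y)"
    and continuous_add: "continuous_map (prod_topology (tvs_top E) (tvs_top E)) (tvs_top E)
        (\<lambda>(x, y). tvs_add E x y)"
    and continuous_scale: "continuous_map (prod_topology euclideanreal (tvs_top E)) (tvs_top E)
        (\<lambda>(c, x). tvs_scale E c x)"

definition tvs_subspace :: "('a, 'b) tvs_scheme \<Rightarrow> 'a set \<Rightarrow> bool"
  where "tvs_subspace E S \<longleftrightarrow> S \<subseteq> tvs_carrier E \<and> tvs_zero E \<in> S \<and>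
    (\<forall>x\<in>S. \<forall>y\<in>S. tvs_add E x y \<in> S) \<and> (\<forall>c. \<forall>x\<in>S. tvs_scale E c x \<in> S)"

definition tvs_coset :: "('a, 'b) tvs_scheme \<Rightarrow> 'a set \<Rightarrow> 'a \<Rightarrow> 'a set"
  where "tvs_coset E S x = tvs_add E x ` S"

text \<open>The finest topology on the image of \<open>topspace X\<close> under \<open>q\<close> that makes \<open>q\<close> continuous.\<close>

definition quot_topology :: "'a topology \<Rightarrow> ('a \<Rightarrow> 'b) \<Rightarrow> 'b topology"
  where "quot_topology X q =
    topology (\<lambda>U. U \<subseteq> q ` topspace X \<and> openin X {x \<in> topspace X. q x \<in> U})"

lemma openin_quot_topology:
  "openin (quot_topology X q) U \<longleftrightarrow>
    U \<subseteq> q ` topspace X \<and> openin X {x \<in> topspace X. q x \<in> U}"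
proof -
  have "istopology (\<lambda>U. U \<subseteq> q ` topspace X \<and> openin X {x \<in> topspace X. q x \<in> U})"
    unfolding istopology_def
  proof (intro conjI allI impI)
    fix S T
    assume S: "S \<subseteq> q ` topspace X \<and> openin X {x \<in> topspace X. q x \<in> S}"
      and T: "T \<subseteq> q ` topspace X \<and> openin X {x \<in> topspace X. q x \<in> T}"
    show "S \<inter> T \<subseteq> q ` topspace X"
      using S by blast
    have "{x \<in> topspace X. q x \<in> S \<inter> T} = {x \<in> topspace X. q x \<in> S} \<inter> {x \<in> topspace X. q x \<in> T}"
      by blast
    then show "openin X {x \<in> topspace X. q x \<in> S \<inter> T}"
      using S T by (simp add: openin_Int)
  next
    fix \<K>
    assume K: "\<forall>U\<in>\<K>. U \<subseteq> q ` topspace X \<and> openin X {x \<in> topspace X. q x \<in> U}"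
    show "\<Union>\<K> \<subseteq> q ` topspace X"
      using K by blast
    have "{x \<in> topspace X. q x \<in> \<Union>\<K>} = (\<Union>U\<in>\<K>. {x \<in> topspace X. q x \<in> U})"
      by blast
    moreover have "openin X (\<Union>U\<in>\<K>. {x \<in> topspace X. q x \<in> U})"
      using K by (intro openin_Union) auto
    ultimately show "openin X {x \<in> topspace X. q x \<in> \<Union>\<K>}"
      by argo
  qed
  then show ?thesis
    by (simp add: quot_topology_def topology_inverse')
qed

lemma topspace_quot_topology [simp]: "topspace (quot_topology X q) = q ` topspace X"
proof (rule antisym)
  show "topspace (quot_topology X q) \<subseteq> q ` topspace X"
    using openin_quot_topology openin_topspace by metis
  have "{x \<in> topspace X. q x \<in> q ` topspace X} = topspace X"
    by blast
  then have "openin (quot_topology X q) (q ` topspace X)"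
    by (simp add: openin_quot_topology)
  then show "q ` topspace X \<subseteq> topspace (quot_topology X q)"
    by (rule openin_subset)
qed

lemma quotient_map_quot_topology: "quotient_map X (quot_topology X q) q"
  by (simp add: quotient_map_def openin_quot_topology)

text \<open>The operations are written directly on cosets, without choosing representatives:
  \<open>(x + S) + (y + S)\<close> is the elementwise sum, and \<open>c (x + S)\<close> is \<open>c \<cdot> (x + S) + S\<close>; the summand \<open>S\<close>
  matters only for \<open>c = 0\<close>.\<close>

definition tvs_quotient :: "('a, 'b) tvs_scheme \<Rightarrow> 'a set \<Rightarrow> 'a set tvs"
  where "tvs_quotient E S = \<lparr>
    tvs_top = quot_topology (tvs_top E) (tvs_coset E S),
    tvs_zero = S,
    tvs_add = (\<lambda>A B. {tvs_add E a b | a b. a \<in> A \<and> b \<in> B}),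
    tvs_scale = (\<lambda>c A. {tvs_add E (tvs_scale E c a) s | a s. a \<in> A \<and> s \<in> S})\<rparr>"

lemma (in real_tvs) tvs_quotient_coset_ops:
  assumes S: "tvs_subspace E S" and x: "x \<in> tvs_carrier E" and y: "y \<in> tvs_carrier E"
  shows "tvs_add (tvs_quotient E S) (tvs_coset E S x) (tvs_coset E S y)
      = tvs_coset E S (tvs_add E x y)"
    and "tvs_scale (tvs_quotient E S) c (tvs_coset E S x) = tvs_coset E S (tvs_scale E c x)"
    and "tvs_zero (tvs_quotient E S) = tvs_coset E S (tvs_zero E)"
proof -
  have sub: "s \<in> tvs_carrier E" if "s \<in> S" for s
    using S that by (auto simp: tvs_subspace_def)
  have S0: "tvs_zero E \<in> S" and Sadd: "\<And>s t. s \<in> S \<Longrightarrow> t \<in> S \<Longrightarrow> tvs_add E s t \<in> S"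
    and Sscale: "\<And>s. s \<in> S \<Longrightarrow> tvs_scale E c s \<in> S"
    using S by (auto simp: tvs_subspace_def)
  have add_zero_right: "tvs_add E v (tvs_zero E) = v" if "v \<in> tvs_carrier E" for v
    using that by (metis add_commute add_zero zero_closed)
  have four: "tvs_add E (tvs_add E x s) (tvs_add E y t) = tvs_add E (tvs_add E x y) (tvs_add E s t)"
    if "s \<in> S" "t \<in> S" for s t
    using sub[OF that(1)] sub[OF that(2)] x y
    by (metis add_assoc add_closed add_commute)
  show "tvs_add (tvs_quotient E S) (tvs_coset E S x) (tvs_coset E S y)
      = tvs_coset E S (tvs_add E x y)"
  proof (rule set_eqI, rule iffI)
    fix z
    assume "z \<in> tvs_add (tvs_quotient E S) (tvs_coset E S x) (tvs_coset E S y)"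
    then obtain s t where "s \<in> S" "t \<in> S" "z = tvs_add E (tvs_add E x s) (tvs_add E y t)"
      by (auto simp: tvs_quotient_def tvs_coset_def)
    then show "z \<in> tvs_coset E S (tvs_add E x y)"
      using four Sadd by (auto simp: tvs_coset_def)
  next
    fix z
    assume "z \<in> tvs_coset E S (tvs_add E x y)"
    then obtain s where s: "s \<in> S" and z: "z = tvs_add E (tvs_add E x y) s"
      by (auto simp: tvs_coset_def)
    have "z = tvs_add E (tvs_add E x s) (tvs_add E y (tvs_zero E))"
      using four[OF s S0] add_zero_right[OF sub[OF s]] z by simp
    then show "z \<in> tvs_add (tvs_quotient E S) (tvs_coset E S x) (tvs_coset E S y)"
      using s S0 by (auto simp: tvs_quotient_def tvs_coset_def)
  qed
  have three: "tvs_add E (tvs_scale E c (tvs_add E x s)) t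
      = tvs_add E (tvs_scale E c x) (tvs_add E (tvs_scale E c s) t)"
    if "s \<in> S" "t \<in> S" for s t
    using sub[OF that(1)] sub[OF that(2)] x
    by (simp add: scale_add_right add_assoc scale_closed)
  show "tvs_scale (tvs_quotient E S) c (tvs_coset E S x) = tvs_coset E S (tvs_scale E c x)"
  proof (rule set_eqI, rule iffI)
    fix z
    assume "z \<in> tvs_scale (tvs_quotient E S) c (tvs_coset E S x)"
    then obtain s t where "s \<in> S" "t \<in> S" "z = tvs_add E (tvs_scale E c (tvs_add E x s)) t"
      by (auto simp: tvs_quotient_def tvs_coset_def)
    then show "z \<in> tvs_coset E S (tvs_scale E c x)"
      using three Sadd Sscale by (auto simp: tvs_coset_def)
  next
    fix z
    assume "z \<in> tvs_coset E S (tvs_scale E c x)"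
    then obtain t where t: "t \<in> S" and z: "z = tvs_add E (tvs_scale E c x) t"
      by (auto simp: tvs_coset_def)
    have "z = tvs_add E (tvs_scale E c (tvs_add E x (tvs_zero E))) t"
      using add_zero_right[OF x] z by simp
    then show "z \<in> tvs_scale (tvs_quotient E S) c (tvs_coset E S x)"
      using t S0 by (auto simp: tvs_quotient_def tvs_coset_def)
  qed
  show "tvs_zero (tvs_quotient E S) = tvs_coset E S (tvs_zero E)"
    using add_zero[OF sub] by (simp add: tvs_quotient_def tvs_coset_def)
qed

definition tvs_isomorphism :: "('a, 'c) tvs_scheme \<Rightarrow> ('b, 'd) tvs_scheme \<Rightarrow> ('a \<Rightarrow> 'b) \<Rightarrow> bool"
  where "tvs_isomorphism E F \<phi> \<longleftrightarrow> homeomorphic_map (tvs_top E) (tvs_top F) \<phi> \<and>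
    (\<forall>x\<in>tvs_carrier E. \<forall>y\<in>tvs_carrier E. \<phi> (tvs_add E x y) = tvs_add F (\<phi> x) (\<phi> y)) \<and>
    (\<forall>c. \<forall>x\<in>tvs_carrier E. \<phi> (tvs_scale E c x) = tvs_scale F c (\<phi> x))"

definition tvs_isomorphic :: "('a, 'c) tvs_scheme \<Rightarrow> ('b, 'd) tvs_scheme \<Rightarrow> bool"
  where "tvs_isomorphic E F \<longleftrightarrow> (\<exists>\<phi>. tvs_isomorphism E F \<phi>)"

definition admits_quotient :: "('a, 'c) tvs_scheme \<Rightarrow> ('b, 'd) tvs_scheme \<Rightarrow> bool"
  where "admits_quotient E F \<longleftrightarrow>
    (\<exists>S. tvs_subspace E S \<and> closedin (tvs_top E) S \<and> tvs_isomorphic (tvs_quotient E S) F)"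


section \<open>The spaces \<open>C\<^sub>p(X)\<close> and \<open>(c\<^sub>0)\<^sub>p\<close>\<close>

text \<open>Functions on \<open>topspace X\<close> are represented extensionally, i.e. with value \<open>undefined\<close> outside
  \<open>topspace X\<close>, as in \<open>product_topology\<close>.\<close>

definition Cp :: "'a topology \<Rightarrow> ('a \<Rightarrow> real) tvs"
  where "Cp X = \<lparr>
    tvs_top = subtopology (powertop_real (topspace X)) {f. continuous_map X euclideanreal f},
    tvs_zero = (\<lambda>x\<in>topspace X. 0),
    tvs_add = (\<lambda>f g. \<lambda>x\<in>topspace X. f x + g x),
    tvs_scale = (\<lambda>c f. \<lambda>x\<in>topspace X. c * f x)\<rparr>"

definition c0p :: "(nat \<Rightarrow> real) tvs"
  where "c0p = \<lparr>
    tvs_top = subtopology (powertop_real UNIV) {x. x \<longlonglongrightarrow> 0},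
    tvs_zero = (\<lambda>n. 0),
    tvs_add = (\<lambda>x y n. x n + y n),
    tvs_scale = (\<lambda>c x n. c * x n)\<rparr>"

lemma tvs_carrier_Cp:
  "tvs_carrier (Cp X) = {f \<in> extensional (topspace X). continuous_map X euclideanreal f}"
  by (auto simp: Cp_def PiE_def)

lemma tvs_carrier_c0p: "tvs_carrier c0p = {x. x \<longlonglongrightarrow> 0}"
  by (simp add: c0p_def)

lemma continuous_map_restrict_topspace:
  "continuous_map X Y (restrict f (topspace X)) \<longleftrightarrow> continuous_map X Y f"
  by (rule iffI; erule continuous_map_eq; simp)

lemma continuous_map_coord_subtopology_powertop:
  assumes "i \<in> I"
  shows "continuous_map (subtopology (powertop_real I) A) euclideanreal (\<lambda>f. f i)"
  using assms by (intro continuous_map_from_subtopology continuous_map_product_projection)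

lemma real_tvs_Cp: "real_tvs (Cp X)"
proof
  let ?T = "tvs_top (Cp X)"
  have coord: "continuous_map ?T euclideanreal (\<lambda>f. f x)" if "x \<in> topspace X" for x
    using that by (simp add: Cp_def continuous_map_coord_subtopology_powertop)
  have into: "continuous_map Z ?T h"
    if "\<And>x. x \<in> topspace X \<Longrightarrow> continuous_map Z euclideanreal (\<lambda>z. h z x)"
      and "h \<in> topspace Z \<rightarrow> tvs_carrier (Cp X)" for Z :: "'z topology" and h
    using that unfolding tvs_carrier_Cp
    by (auto simp: Cp_def continuous_map_in_subtopology continuous_map_componentwise)
  show add: "tvs_add (Cp X) f g \<in> tvs_carrier (Cp X)"
    if "f \<in> tvs_carrier (Cp X)" "g \<in> tvs_carrier (Cp X)" for f g
    using that unfolding tvs_carrier_Cp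
    by (auto simp: Cp_def continuous_map_restrict_topspace intro: continuous_map_add)
  show scale: "tvs_scale (Cp X) c f \<in> tvs_carrier (Cp X)" if "f \<in> tvs_carrier (Cp X)" for c f
    using that unfolding tvs_carrier_Cp
    by (auto simp: Cp_def continuous_map_restrict_topspace intro: continuous_map_real_mult_left)
  show "continuous_map (prod_topology ?T ?T) ?T (\<lambda>(f, g). tvs_add (Cp X) f g)"
  proof (rule into)
    fix x assume x: "x \<in> topspace X"
    have "continuous_map (prod_topology ?T ?T) euclideanreal (\<lambda>p. fst p x + snd p x)"
      by (intro continuous_map_add
          continuous_map_compose[OF continuous_map_fst coord[OF x], unfolded o_def]
          continuous_map_compose[OF continuous_map_snd coord[OF x], unfolded o_def])
    then show "continuous_map (prod_topology ?T ?T) euclideanreal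
        (\<lambda>p. (case p of (f, g) \<Rightarrow> tvs_add (Cp X) f g) x)"
      using x by (simp add: Cp_def case_prod_unfold)
  qed (auto intro: add)
  show "continuous_map (prod_topology euclideanreal ?T) ?T (\<lambda>(c, f). tvs_scale (Cp X) c f)"
  proof (rule into)
    fix x assume x: "x \<in> topspace X"
    have "continuous_map (prod_topology euclideanreal ?T) euclideanreal (\<lambda>p. fst p * snd p x)"
      by (intro continuous_map_real_mult continuous_map_fst
          continuous_map_compose[OF continuous_map_snd coord[OF x], unfolded o_def])
    then show "continuous_map (prod_topology euclideanreal ?T) euclideanreal
        (\<lambda>p. (case p of (c, f) \<Rightarrow> tvs_scale (Cp X) c f) x)"
      using x by (simp add: Cp_def case_prod_unfold)
  qed (auto intro: scale)
qed (auto simp: tvs_carrier_Cp, auto simp: Cp_def continuous_map_restrict_topspace algebra_simps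
      intro!: extensionalityI[where A = "topspace X"])

lemma real_tvs_c0p: "real_tvs c0p"
proof
  let ?T = "tvs_top c0p"
  have coord: "continuous_map ?T euclideanreal (\<lambda>x. x n)" for n
    by (simp add: c0p_def continuous_map_coord_subtopology_powertop)
  have into: "continuous_map Z ?T h"
    if "\<And>n. continuous_map Z euclideanreal (\<lambda>z. h z n)"
      and "h \<in> topspace Z \<rightarrow> tvs_carrier c0p" for Z :: "'z topology" and h
    using that unfolding tvs_carrier_c0p
    by (auto simp: c0p_def continuous_map_in_subtopology continuous_map_componentwise)
  show add: "tvs_add c0p x y \<in> tvs_carrier c0p"
    if "x \<in> tvs_carrier c0p" "y \<in> tvs_carrier c0p" for x y
    using that tendsto_add[of x 0 sequentially y 0] by (simp add: c0p_def)
  show scale: "tvs_scale c0p c x \<in> tvs_carrier c0p" if "x \<in> tvs_carrier c0p" for c x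
    using that tendsto_mult_right_zero[of x sequentially c] by (simp add: c0p_def)
  show "continuous_map (prod_topology ?T ?T) ?T (\<lambda>(x, y). tvs_add c0p x y)"
  proof (rule into)
    fix n
    have "continuous_map (prod_topology ?T ?T) euclideanreal (\<lambda>p. fst p n + snd p n)"
      by (intro continuous_map_add
          continuous_map_compose[OF continuous_map_fst coord, unfolded o_def]
          continuous_map_compose[OF continuous_map_snd coord, unfolded o_def])
    then show "continuous_map (prod_topology ?T ?T) euclideanreal
        (\<lambda>p. (case p of (x, y) \<Rightarrow> tvs_add c0p x y) n)"
      by (simp add: c0p_def case_prod_unfold)
  qed (auto intro: add)
  show "continuous_map (prod_topology euclideanreal ?T) ?T (\<lambda>(c, x). tvs_scale c0p c x)"
  proof (rule into)
    fix n
    have "continuous_map (prod_topology euclideanreal ?T) euclideanreal (\<lambda>p. fst p * snd p n)"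
      by (intro continuous_map_real_mult continuous_map_fst
          continuous_map_compose[OF continuous_map_snd coord, unfolded o_def])
    then show "continuous_map (prod_topology euclideanreal ?T) euclideanreal
        (\<lambda>p. (case p of (c, x) \<Rightarrow> tvs_scale c0p c x) n)"
      by (simp add: c0p_def case_prod_unfold)
  qed (auto intro: scale)
qed (auto simp: c0p_def algebra_simps)

end

theory Submission
  imports Defs
begin

text \<open>A continuous linear map \<open>T\<close> from \<open>C\<^sub>p(K \<times> L)\<close> to \<open>(c\<^sub>0)\<^sub>p\<close> that has a continuous right inverse is a
  topological quotient map, so that \<open>(c\<^sub>0)\<^sub>p\<close> is the quotient by its kernel
  (\<open>admits_quotient_of_linear_retraction\<close>). A map into \<open>(c\<^sub>0)\<^sub>p\<close> is continuous as soon as its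
  coordinates are, so \<open>T\<close> may be given by a sequence of finitely supported signed measures \<open>\<mu>\<^sub>n\<close> with
  \<open>\<mu>\<^sub>n(f) \<longlonglongrightarrow> 0\<close> for every continuous \<open>f\<close>. If there are continuous functions \<open>\<phi>\<^sub>n\<close>, bounded
  by \<open>1\<close> and disjointly supported, with \<open>\<mu>\<^sub>n(\<phi>\<^sub>n) = 1\<close> and with \<open>\<phi>\<^sub>m = 0\<close> on the support of \<open>\<mu>\<^sub>n\<close> for
  \<open>m \<noteq> n\<close>, then \<open>a \<mapsto> \<Sum>\<^sub>n a\<^sub>n \<phi>\<^sub>n\<close> is such a right inverse: the sum
  converges uniformly since \<open>a\<close> tends to \<open>0\<close>, and at each point it depends on one coordinate of \<open>a\<close>
  only (\<open>Cp_admits_quotient_c0p\<close>).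

  The product structure supplies the measures. Choose infinitely many points in \<open>K\<close> and in \<open>L\<close> with
  disjointly supported bump functions (\<open>disjoint_bump_functions\<close>), index those of \<open>K\<close> as \<open>x\<^sub>n\<^sub>,\<^sub>i\<close> and
  those of \<open>L\<close> as \<open>y\<^sub>s\<close> by finite sets \<open>s\<close> of numbers, and let \<open>\<mu>\<^sub>n\<close> be the signed measure of total
  variation \<open>1\<close> that is uniformly distributed, up to signs, on the points \<open>(x\<^sub>n\<^sub>,\<^sub>i, y\<^sub>s)\<close> with
  \<open>i \<le> n\<close> and \<open>s \<subseteq> {0..n}\<close>, with sign \<open>+\<close> exactly when \<open>i \<in> s\<close>. These signs are the Rademacher
  functions on the power set: the rows of the sign matrix are orthogonal, so by Cauchy--Schwarz a
  fixed bounded function of \<open>s\<close> is almost orthogonal to most rows (\<open>sum_abs_rademacher_le\<close>). For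
  continuous \<open>f\<close> the slices \<open>f(x, \<cdot>)\<close> form a totally bounded set in the sup norm, as \<open>K\<close> and \<open>L\<close>
  are compact, so up to \<open>\<epsilon>\<close> only finitely many functions of \<open>s\<close> occur, and \<open>\<mu>\<^sub>n(f) \<longlonglongrightarrow> 0\<close>
  (\<open>rademacher_averages_tendsto_0\<close>). The same signs attached to the products of bump functions give
  the \<open>\<phi>\<^sub>n\<close>.\<close>

section \<open>Quotients by kernels of linear retractions\<close>

text \<open>A retraction is a quotient map, and its fibres are the cosets of its kernel; hence it factors
  through the projection onto the cosets by an injective quotient map, that is, a homeomorphism.\<close>

lemma admits_quotient_of_linear_retraction:
  assumes E: "real_tvs E" and F: "real_tvs F" and "Hausdorff_space (tvs_top F)"
    and T: "retraction_map (tvs_top E) (tvs_top F) T"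
    and T_add: "\<And>x y. x \<in> tvs_carrier E \<Longrightarrow> y \<in> tvs_carrier E
        \<Longrightarrow> T (tvs_add E x y) = tvs_add F (T x) (T y)"
    and T_scale: "\<And>c x. x \<in> tvs_carrier E \<Longrightarrow> T (tvs_scale E c x) = tvs_scale F c (T x)"
  shows "admits_quotient E F"
proof -
  interpret E: real_tvs E by fact
  interpret F: real_tvs F by fact
  have quotT: "quotient_map (tvs_top E) (tvs_top F) T"
    using T by (rule retraction_imp_quotient_map)
  then have contT: "continuous_map (tvs_top E) (tvs_top F) T"
    by (rule quotient_imp_continuous_map)
  have T_closed: "T x \<in> tvs_carrier F" if "x \<in> tvs_carrier E" for x
    using continuous_map_funspace[OF contT] that by blast
  have T_zero: "T (tvs_zero E) = tvs_zero F"
    using T_add[of "tvs_zero E" "tvs_scale E (- 1) (tvs_zero E)"] T_scale[of "tvs_zero E" "- 1"]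
      E.add_inverse F.add_inverse E.zero_closed E.scale_closed T_closed by metis
  define N where "N = {x \<in> tvs_carrier E. T x \<in> {tvs_zero F}}"
  have N: "tvs_subspace E N"
    unfolding tvs_subspace_def
  proof (intro conjI ballI allI)
    fix x y assume "x \<in> N" "y \<in> N"
    then show "tvs_add E x y \<in> N"
      by (simp add: N_def T_add E.add_closed F.add_zero F.zero_closed)
  next
    fix c x assume x: "x \<in> N"
    let ?o = "tvs_zero F"
    note o = F.zero_closed
    have "tvs_scale F c ?o = tvs_scale F c (tvs_add F ?o (tvs_scale F (- 1) ?o))"
      by (simp add: F.add_inverse[OF o])
    also have "\<dots> = tvs_add F (tvs_scale F c ?o) (tvs_scale F (- 1) (tvs_scale F c ?o))"
      by (simp add: F.scale_add_right o F.scale_closed F.scale_scale)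
    also have "\<dots> = ?o"
      by (rule F.add_inverse[OF F.scale_closed[OF o]])
    finally have "tvs_scale F c ?o = ?o" .
    then show "tvs_scale E c x \<in> N"
      using x by (simp add: N_def T_scale E.scale_closed)
  qed (auto simp: N_def T_zero E.zero_closed)
  have closedN: "closedin (tvs_top E) N"
    unfolding N_def
    using contT by (rule closedin_continuous_map_preimage)
      (simp add: closedin_Hausdorff_singleton assms(3) F.zero_closed)
  let ?q = "tvs_coset E N"
  have coset: "?q x = {z \<in> tvs_carrier E. T z = T x}" if x: "x \<in> tvs_carrier E" for x
  proof (intro set_eqI iffI)
    fix z assume "z \<in> ?q x"
    then obtain s where "s \<in> N" "z = tvs_add E x s"
      by (auto simp: tvs_coset_def)
    then show "z \<in> {z \<in> tvs_carrier E. T z = T x}"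
      using x by (simp add: N_def E.add_closed T_add F.add_commute F.add_zero F.zero_closed T_closed)
  next
    fix z assume "z \<in> {z \<in> tvs_carrier E. T z = T x}"
    then have z: "z \<in> tvs_carrier E" and Tz: "T z = T x" by auto
    let ?s = "tvs_add E (tvs_scale E (- 1) x) z"
    have mx: "tvs_scale E (- 1) x \<in> tvs_carrier E"
      using x by (rule E.scale_closed)
    have "T ?s = tvs_add F (tvs_scale F (- 1) (T x)) (T x)"
      using mx z x by (simp add: T_add T_scale Tz)
    also have "\<dots> = tvs_zero F"
      using F.add_inverse F.add_commute F.scale_closed T_closed x by metis
    finally have "?s \<in> N"
      using mx z by (simp add: N_def E.add_closed)
    moreover have "tvs_add E x ?s = z"
      using E.add_assoc[OF x mx z] E.add_inverse[OF x] E.add_zero[OF z] by simp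
    ultimately show "z \<in> ?q x"
      unfolding tvs_coset_def by (metis imageI)
  qed
  \<comment> \<open>\<open>T\<close> is constant on each coset, so the chosen representative is immaterial.\<close>
  define \<phi> where "\<phi> A = T (SOME z. z \<in> A)" for A
  have \<phi>: "\<phi> (?q x) = T x" if "x \<in> tvs_carrier E" for x
    using someI[of "\<lambda>z. z \<in> ?q x" x] that by (simp add: \<phi>_def coset)
  have top: "tvs_top (tvs_quotient E N) = quot_topology (tvs_top E) ?q"
    by (simp add: tvs_quotient_def)
  have "quotient_map (tvs_top E) (tvs_top F) (\<phi> \<circ> ?q)"
    using quotT by (rule quotient_map_eq) (simp add: \<phi>)
  then have "quotient_map (quot_topology (tvs_top E) ?q) (tvs_top F) \<phi>"
    by (simp add: quotient_map_compose_eq[OF quotient_map_quot_topology])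
  moreover have "inj_on \<phi> (?q ` tvs_carrier E)"
  proof (rule inj_onI)
    fix A B assume "A \<in> ?q ` tvs_carrier E" "B \<in> ?q ` tvs_carrier E" and eq: "\<phi> A = \<phi> B"
    then obtain x y where "A = ?q x" "x \<in> tvs_carrier E" "B = ?q y" "y \<in> tvs_carrier E"
      by blast
    moreover from this have "T x = T y" using eq by (simp add: \<phi>)
    ultimately show "A = B" by (simp add: coset)
  qed
  ultimately have "homeomorphic_map (tvs_top (tvs_quotient E N)) (tvs_top F) \<phi>"
    by (simp add: top homeomorphic_map_def)
  then have "tvs_isomorphism (tvs_quotient E N) F \<phi>"
    unfolding tvs_isomorphism_def
    by (auto simp: top E.tvs_quotient_coset_ops[OF N] \<phi> E.add_closed E.scale_closed T_add T_scale)
  then show ?thesis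
    unfolding admits_quotient_def tvs_isomorphic_def using N closedN by blast
qed

section \<open>Biorthogonal systems\<close>

text \<open>The function is the sum of all \<open>a n * \<phi> n\<close>, of which only the term with index \<open>N p\<close> can be
  nonzero at \<open>p\<close>. Its distance to the \<open>m\<close>-th partial sum is at most the supremum of \<open>\<bar>a n\<bar>\<close> over
  \<open>n \<ge> m\<close>, so it is a uniform limit of continuous functions.\<close>

lemma continuous_map_c0_combination:
  fixes \<phi> :: "nat \<Rightarrow> 'a \<Rightarrow> real" and N :: "'a \<Rightarrow> nat"
  assumes cont: "\<And>n. continuous_map X euclideanreal (\<phi> n)"
    and bound: "\<And>n p. p \<in> topspace X \<Longrightarrow> \<bar>\<phi> n p\<bar> \<le> 1"
    and N: "\<And>n p. p \<in> topspace X \<Longrightarrow> n \<noteq> N p \<Longrightarrow> \<phi> n p = 0"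
    and a: "a \<longlonglongrightarrow> 0"
  shows "continuous_map X euclideanreal (\<lambda>p. a (N p) * \<phi> (N p) p)"
proof -
  define s where "s m p = (\<Sum>n<m. a n * \<phi> n p)" for m p
  have s: "s m p = (if N p < m then a (N p) * \<phi> (N p) p else 0)" if "p \<in> topspace X" for m p
  proof -
    have "s m p = (\<Sum>n<m. if n = N p then a n * \<phi> n p else 0)"
      unfolding s_def using N[OF that] by (intro sum.cong) auto
    then show ?thesis by simp
  qed
  have "continuous_map X Met_TC.mtopology (\<lambda>p. a (N p) * \<phi> (N p) p)"
  proof (rule Met_TC.continuous_map_uniform_limit[where F = sequentially and f = s])
    show "\<forall>\<^sub>F m in sequentially. continuous_map X Met_TC.mtopology (s m)"
      unfolding s_def using cont
      by (auto intro!: always_eventually continuous_map_sum continuous_map_real_mult_left)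
  next
    fix \<epsilon> :: real assume "0 < \<epsilon>"
    then obtain m0 where m0: "\<And>n. n \<ge> m0 \<Longrightarrow> \<bar>a n\<bar> < \<epsilon>"
      using a unfolding LIMSEQ_iff by (metis diff_zero real_norm_def)
    have "dist (s m p) (a (N p) * \<phi> (N p) p) < \<epsilon>" if "m \<ge> m0" "p \<in> topspace X" for m p
    proof (cases "N p < m")
      case True
      then show ?thesis using s that \<open>0 < \<epsilon>\<close> by simp
    next
      case False
      have "\<bar>a (N p) * \<phi> (N p) p\<bar> \<le> \<bar>a (N p)\<bar>"
        using bound[OF that(2)] by (simp add: abs_mult mult_left_le)
      also have "\<dots> < \<epsilon>" using False that m0 by auto
      finally show ?thesis using s[OF that(2)] False by (simp add: dist_real_def)
    qed
    then show "\<forall>\<^sub>F m in sequentially. \<forall>p\<in>topspace X. a (N p) * \<phi> (N p) p \<in> UNIV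
        \<and> dist (s m p) (a (N p) * \<phi> (N p) p) < \<epsilon>"
      unfolding eventually_sequentially by auto
  qed auto
  then show ?thesis by simp
qed

text \<open>Evaluation against the measures \<open>\<Sum>j\<in>J n. w n j \<cdot> \<delta>(z n j)\<close> is a continuous linear map into
  \<open>(c\<^sub>0)\<^sub>p\<close>, and \<open>a \<mapsto> \<Sum>\<^sub>n a\<^sub>n \<phi>\<^sub>n\<close> is a right inverse by biorthogonality. The right inverse is
  continuous for the pointwise topologies because its value at a point is a multiple of a single
  coordinate of \<open>a\<close>.\<close>

lemma Cp_admits_quotient_c0p:
  fixes X :: "'a topology" and \<phi> :: "nat \<Rightarrow> 'a \<Rightarrow> real"
    and J :: "nat \<Rightarrow> 'j set" and z :: "nat \<Rightarrow> 'j \<Rightarrow> 'a" and w :: "nat \<Rightarrow> 'j \<Rightarrow> real"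
  assumes z: "\<And>n j. j \<in> J n \<Longrightarrow> z n j \<in> topspace X"
    and null: "\<And>f. continuous_map X euclideanreal f \<Longrightarrow> (\<lambda>n. \<Sum>j\<in>J n. w n j * f (z n j)) \<longlonglongrightarrow> 0"
    and cont: "\<And>n. continuous_map X euclideanreal (\<phi> n)"
    and bound: "\<And>n p. p \<in> topspace X \<Longrightarrow> \<bar>\<phi> n p\<bar> \<le> 1"
    and disjoint: "\<And>m n p. p \<in> topspace X \<Longrightarrow> m \<noteq> n \<Longrightarrow> \<phi> m p = 0 \<or> \<phi> n p = 0"
    and biorthogonal: "\<And>n. (\<Sum>j\<in>J n. w n j * \<phi> n (z n j)) = 1"
      "\<And>m n j. j \<in> J n \<Longrightarrow> m \<noteq> n \<Longrightarrow> \<phi> m (z n j) = 0"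
  shows "admits_quotient (Cp X) c0p"
proof -
  define T where "T f n = (\<Sum>j\<in>J n. w n j * f (z n j))" for f n
  \<comment> \<open>Where all \<open>\<phi> n\<close> vanish, \<open>N p\<close> is an arbitrary index, and the value of \<open>S a\<close> below is still \<open>0\<close>.\<close>
  define N where "N p = (SOME n. \<phi> n p \<noteq> 0)" for p
  have N: "\<phi> n p = 0" if "p \<in> topspace X" "n \<noteq> N p" for n p
  proof (rule ccontr)
    assume "\<phi> n p \<noteq> 0"
    moreover from this have "\<phi> (N p) p \<noteq> 0"
      unfolding N_def by (rule someI)
    ultimately show False using disjoint that by blast
  qed
  define S where "S a = (\<lambda>p\<in>topspace X. a (N p) * \<phi> (N p) p)" for a
  have S_eq: "S a p = a n * \<phi> n p" if "\<And>m. m \<noteq> n \<Longrightarrow> \<phi> m p = 0" "p \<in> topspace X" for a n p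
    using that by (cases "N p = n") (auto simp: S_def N)
  have T_S: "T (S a) = a" for a
  proof
    fix n
    have "T (S a) n = (\<Sum>j\<in>J n. a n * (w n j * \<phi> n (z n j)))"
      unfolding T_def by (intro sum.cong refl) (simp add: S_eq[where n=n] biorthogonal(2) z)
    then show "T (S a) n = a n"
      by (simp add: biorthogonal(1) flip: sum_distrib_left)
  qed
  have coord: "continuous_map (tvs_top (Cp X)) euclideanreal (\<lambda>f. f p)" if "p \<in> topspace X" for p
    using that by (simp add: Cp_def continuous_map_coord_subtopology_powertop)
  have coord0: "continuous_map (tvs_top c0p) euclideanreal (\<lambda>a. a n)" for n
    by (simp add: c0p_def continuous_map_coord_subtopology_powertop)
  have coordT: "continuous_map (tvs_top (Cp X)) euclideanreal (\<lambda>f. T f n)" for n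
    unfolding T_def
  proof (cases "finite (J n)")
    case True
    then show "continuous_map (tvs_top (Cp X)) euclideanreal (\<lambda>f. \<Sum>j\<in>J n. w n j * f (z n j))"
      by (intro continuous_map_sum continuous_map_real_mult_left coord z)
  qed simp
  have T_null: "T f \<longlonglongrightarrow> 0" if "continuous_map X euclideanreal f" for f
    unfolding T_def using that by (rule null)
  have "continuous_map (tvs_top (Cp X)) (tvs_top c0p) T"
    using T_null coordT tvs_carrier_Cp[of X]
    by (auto simp: c0p_def continuous_map_in_subtopology continuous_map_componentwise)
  moreover have "continuous_map (tvs_top c0p) (tvs_top (Cp X)) S"
  proof -
    have "continuous_map X euclideanreal (S a)" if "a \<in> tvs_carrier c0p" for a
      using continuous_map_c0_combination[OF cont bound N] that
      by (simp add: S_def continuous_map_restrict_topspace tvs_carrier_c0p)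
    moreover have "continuous_map (tvs_top c0p) euclideanreal (\<lambda>a. S a p)"
      if "p \<in> topspace X" for p
      using that coord0 by (simp add: S_def continuous_map_real_mult_right)
    moreover have "S a \<in> extensional (topspace X)" for a
      by (simp add: S_def)
    ultimately show ?thesis
      by (auto simp: Cp_def continuous_map_in_subtopology continuous_map_componentwise)
  qed
  ultimately have "retraction_map (tvs_top (Cp X)) (tvs_top c0p) T"
    unfolding retraction_map_def retraction_maps_def using T_S by blast
  moreover have "Hausdorff_space (tvs_top c0p)"
    by (simp add: c0p_def Hausdorff_space_subtopology Hausdorff_space_product_topology)
  moreover have "T (tvs_add (Cp X) f g) = tvs_add c0p (T f) (T g)" for f g
    by (auto simp: T_def Cp_def c0p_def z algebra_simps simp flip: sum.distrib intro!: sum.cong)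
  moreover have "T (tvs_scale (Cp X) c f) = tvs_scale c0p c (T f)" for c f
    by (auto simp: T_def Cp_def c0p_def z sum_distrib_left mult_ac intro!: sum.cong)
  ultimately show ?thesis
    by (intro admits_quotient_of_linear_retraction real_tvs_Cp real_tvs_c0p)
qed

section \<open>Rademacher averages\<close>

definition rademacher :: "'i \<Rightarrow> 'i set \<Rightarrow> real"
  where "rademacher i s = (if i \<in> s then 1 else - 1)"

lemma rademacher_square [simp]: "rademacher i s * rademacher i s = 1"
  by (simp add: rademacher_def)

lemma abs_rademacher [simp]: "\<bar>rademacher i s\<bar> = 1"
  by (simp add: rademacher_def)

text \<open>This says that the functions \<open>rademacher i\<close> are orthogonal on \<open>Pow I\<close>, each with squared norm
  \<open>2 ^ card I\<close>. A new index \<open>k\<close> splits each subset \<open>s\<close> into \<open>s\<close> and \<open>insert k s\<close>, for which the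
  inner sum changes by \<open>- e k\<close> and \<open>+ e k\<close>; the parallelogram law gives the induction step.\<close>

lemma sum_Pow_rademacher_square:
  assumes "finite I"
  shows "(\<Sum>s\<in>Pow I. (\<Sum>i\<in>I. e i * rademacher i s)\<^sup>2) = 2 ^ card I * (\<Sum>i\<in>I. (e i)\<^sup>2)"
  using assms
proof induction
  case empty
  then show ?case by simp
next
  case (insert k I)
  let ?r = "\<lambda>s. \<Sum>i\<in>I. e i * rademacher i s"
  have r_insert: "?r (insert k s) = ?r s" for s
    using insert.hyps by (intro sum.cong) (auto simp: rademacher_def)
  have inj: "inj_on (insert k) (Pow I)"
    using insert.hyps by (auto intro!: inj_onI)
  have "(\<Sum>s\<in>Pow (insert k I). (\<Sum>i\<in>insert k I. e i * rademacher i s)\<^sup>2)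
      = (\<Sum>s\<in>Pow I. (\<Sum>i\<in>insert k I. e i * rademacher i s)\<^sup>2)
        + (\<Sum>s\<in>insert k ` Pow I. (\<Sum>i\<in>insert k I. e i * rademacher i s)\<^sup>2)"
    unfolding Pow_insert using insert.hyps by (intro sum.union_disjoint) auto
  also have "\<dots> = (\<Sum>s\<in>Pow I. (?r s - e k)\<^sup>2) + (\<Sum>s\<in>Pow I. (?r s + e k)\<^sup>2)"
  proof (intro arg_cong2[of _ _ _ _ "(+)"])
    show "(\<Sum>s\<in>Pow I. (\<Sum>i\<in>insert k I. e i * rademacher i s)\<^sup>2) = (\<Sum>s\<in>Pow I. (?r s - e k)\<^sup>2)"
    proof (intro sum.cong refl)
      fix s assume "s \<in> Pow I"
      then have "rademacher k s = - 1"
        using insert.hyps by (auto simp: rademacher_def)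
      then show "(\<Sum>i\<in>insert k I. e i * rademacher i s)\<^sup>2 = (?r s - e k)\<^sup>2"
        using insert.hyps by simp
    qed
    have "rademacher k (insert k s) = 1" for s
      by (simp add: rademacher_def)
    then show "(\<Sum>s\<in>insert k ` Pow I. (\<Sum>i\<in>insert k I. e i * rademacher i s)\<^sup>2)
        = (\<Sum>s\<in>Pow I. (?r s + e k)\<^sup>2)"
      using insert.hyps by (simp add: sum.reindex[OF inj] r_insert add.commute)
  qed
  also have "\<dots> = (\<Sum>s\<in>Pow I. 2 * (?r s)\<^sup>2 + 2 * (e k)\<^sup>2)"
    unfolding sum.distrib[symmetric] by (intro sum.cong) (auto simp: power2_eq_square algebra_simps)
  also have "\<dots> = 2 * (\<Sum>s\<in>Pow I. (?r s)\<^sup>2) + 2 * 2 ^ card I * (e k)\<^sup>2"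
    using insert.hyps by (simp add: sum.distrib card_Pow flip: sum_distrib_left)
  also have "\<dots> = 2 ^ card (insert k I) * (\<Sum>i\<in>insert k I. (e i)\<^sup>2)"
    using insert by (simp add: algebra_simps)
  finally show ?case .
qed

text \<open>The trivial bound has \<open>card I\<close> in place of its square root. Writing each absolute value as a
  sign \<open>e i\<close> times the sum turns the left-hand side into the inner product of \<open>g\<close> with
  \<open>\<Sum>i\<in>I. e i * rademacher i\<close>, to which Cauchy--Schwarz and orthogonality apply.\<close>

lemma sum_abs_rademacher_le:
  assumes "finite I" and g: "\<And>s. s \<subseteq> I \<Longrightarrow> \<bar>g s\<bar> \<le> M"
  shows "(\<Sum>i\<in>I. \<bar>\<Sum>s\<in>Pow I. rademacher i s * g s\<bar>) \<le> M * (2 ^ card I * sqrt (card I))"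
proof -
  define e where "e i = sgn (\<Sum>s\<in>Pow I. rademacher i s * g s)" for i
  define r where "r s = (\<Sum>i\<in>I. e i * rademacher i s)" for s
  have M: "0 \<le> M" using g[of "{}"] by auto
  have "(\<Sum>i\<in>I. \<bar>\<Sum>s\<in>Pow I. rademacher i s * g s\<bar>)
      = (\<Sum>i\<in>I. e i * (\<Sum>s\<in>Pow I. rademacher i s * g s))"
    by (simp add: e_def abs_sgn mult.commute)
  also have "\<dots> = (\<Sum>s\<in>Pow I. g s * r s)"
    unfolding r_def sum_distrib_left by (subst sum.swap) (simp add: mult_ac)
  also have "\<dots> \<le> (\<Sum>s\<in>Pow I. \<bar>g s\<bar> * \<bar>r s\<bar>)"
    by (intro sum_mono) (metis abs_ge_self abs_mult)
  also have "\<dots> \<le> L2_set g (Pow I) * L2_set r (Pow I)"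
    by (rule L2_set_mult_ineq)
  also have "\<dots> \<le> sqrt (2 ^ card I * M\<^sup>2) * sqrt (2 ^ card I * card I)"
  proof (intro mult_mono)
    have "(g s)\<^sup>2 \<le> M\<^sup>2" if "s \<in> Pow I" for s
      using g[of s] that M by (simp add: abs_le_square_iff[symmetric])
    then have "(\<Sum>s\<in>Pow I. (g s)\<^sup>2) \<le> (\<Sum>s\<in>Pow I. M\<^sup>2)"
      by (rule sum_mono)
    then show "L2_set g (Pow I) \<le> sqrt (2 ^ card I * M\<^sup>2)"
      using \<open>finite I\<close> by (simp add: L2_set_def card_Pow)
    have "(e i)\<^sup>2 \<le> 1" for i
      by (simp add: e_def sgn_if)
    then have "(\<Sum>i\<in>I. (e i)\<^sup>2) \<le> card I"
      using sum_bounded_above[of I "\<lambda>i. (e i)\<^sup>2" 1] by simp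
    then show "L2_set r (Pow I) \<le> sqrt (2 ^ card I * card I)"
      unfolding L2_set_def r_def sum_Pow_rademacher_square[OF \<open>finite I\<close>] by simp
  qed auto
  also have "\<dots> = M * (2 ^ card I * sqrt (card I))"
    using M by (simp add: real_sqrt_mult)
  finally show ?thesis .
qed

text \<open>Total boundedness of the slices of \<open>f\<close> in the sup norm: by the tube lemma, which uses that \<open>L\<close>
  is compact, each slice is uniformly close to those at nearby points, and finitely many such
  neighbourhoods cover \<open>K\<close>.\<close>

lemma finite_uniform_net_of_slices:
  fixes f :: "'a \<times> 'b \<Rightarrow> real"
  assumes K: "compact_space K" and L: "compact_space L"
    and f: "continuous_map (prod_topology K L) euclideanreal f" and "0 < \<epsilon>"
  obtains Z where "finite Z" "Z \<subseteq> topspace K"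
    "\<And>x. x \<in> topspace K \<Longrightarrow> \<exists>z\<in>Z. \<forall>y\<in>topspace L. \<bar>f (x, y) - f (z, y)\<bar> \<le> \<epsilon>"
proof -
  have "\<exists>U. openin K U \<and> z \<in> U \<and> (\<forall>x\<in>U. \<forall>y\<in>topspace L. \<bar>f (x, y) - f (z, y)\<bar> < \<epsilon>)"
    if z: "z \<in> topspace K" for z
  proof -
    let ?W = "{p \<in> topspace (prod_topology K L). f p - f (z, snd p) \<in> {-\<epsilon><..<\<epsilon>}}"
    have "continuous_map (prod_topology K L) (prod_topology K L) (\<lambda>p. (z, snd p))"
      using z by (intro continuous_map_pairedI) (auto intro: continuous_map_snd)
    from continuous_map_compose[OF this f]
    have "continuous_map (prod_topology K L) euclideanreal (\<lambda>p. f p - f (z, snd p))"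
      using f by (intro continuous_map_diff) (simp_all add: o_def)
    then have W: "openin (prod_topology K L) ?W"
      by (rule openin_continuous_map_preimage) simp
    have "{z} \<times> topspace L \<subseteq> ?W"
      using z \<open>0 < \<epsilon>\<close> by auto
    with W obtain U V where "openin K U" "openin L V" "{z} \<subseteq> U" "topspace L \<subseteq> V" "U \<times> V \<subseteq> ?W"
      using Wallace_theorem_prod_topology[of K "{z}" L "topspace L" ?W] z L
      by (auto simp: compact_space_def)
    then show ?thesis
      by (intro exI[of _ U]) fastforce
  qed
  then obtain U where U: "\<And>z. z \<in> topspace K \<Longrightarrow> openin K (U z) \<and> z \<in> U z \<and>
      (\<forall>x\<in>U z. \<forall>y\<in>topspace L. \<bar>f (x, y) - f (z, y)\<bar> < \<epsilon>)"
    by metis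
  have "topspace K \<subseteq> \<Union> (U ` topspace K)" using U by blast
  moreover have "\<forall>V\<in>U ` topspace K. openin K V" using U by blast
  ultimately obtain \<F> where \<F>: "finite \<F>" "\<F> \<subseteq> U ` topspace K" "topspace K \<subseteq> \<Union> \<F>"
    using K unfolding compact_space_def compactin_def by meson
  then obtain Z where Z: "Z \<subseteq> topspace K" "finite Z" "\<F> = U ` Z"
    by (meson finite_subset_image)
  have "\<exists>z\<in>Z. \<forall>y\<in>topspace L. \<bar>f (x, y) - f (z, y)\<bar> \<le> \<epsilon>" if x: "x \<in> topspace K" for x
  proof -
    obtain z where "z \<in> Z" "x \<in> U z" using \<F>(3) Z(3) x by blast
    then show ?thesis using U Z by (meson less_imp_le subsetD)
  qed
  then show thesis using that Z by blast
qed

text \<open>Replace each slice \<open>f (x n i, \<cdot>)\<close> by one of a finite \<open>\<epsilon>\<close>-net. Which net element is used may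
  depend on \<open>i\<close> in an uncontrolled way, but bounding its contribution by the sum over the whole net
  costs only the factor \<open>card Z\<close>, which does not depend on \<open>n\<close>, while each net element contributes
  \<open>O(1 / sqrt n)\<close>.\<close>

lemma rademacher_averages_tendsto_0:
  fixes K :: "'a topology" and L :: "'b topology" and f :: "'a \<times> 'b \<Rightarrow> real"
  assumes K: "compact_space K" and L: "compact_space L"
    and f: "continuous_map (prod_topology K L) euclideanreal f"
    and x: "\<And>n i. x n i \<in> topspace K" and y: "\<And>s. y s \<in> topspace L"
  shows "(\<lambda>n. (\<Sum>i\<le>n. \<Sum>s\<in>Pow {..n}. rademacher i s * f (x n i, y s)) / (real (Suc n) * 2 ^ Suc n))
      \<longlonglongrightarrow> 0"
proof -
  have "compactin euclideanreal (f ` topspace (prod_topology K L))"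
    using K L f compact_space_prod_topology[of K L]
    by (intro image_compactin[of "prod_topology K L"]) (simp_all add: compact_space_def)
  then have "bounded (f ` topspace (prod_topology K L))"
    by (auto intro: compact_imp_bounded)
  then obtain M where M: "\<And>p. p \<in> topspace (prod_topology K L) \<Longrightarrow> \<bar>f p\<bar> \<le> M"
    by (auto simp: bounded_iff)
  let ?A = "\<lambda>n. \<Sum>i\<le>n. \<Sum>s\<in>Pow {..n}. rademacher i s * f (x n i, y s)"
  have est: "\<exists>C. \<forall>n. \<bar>?A n / (real (Suc n) * 2 ^ Suc n)\<bar> \<le> C / sqrt (Suc n) + \<epsilon>" if \<epsilon>: "0 < \<epsilon>" for \<epsilon> :: real
  proof -
    obtain Z where Z: "finite Z" "Z \<subseteq> topspace K"
      and net: "\<And>x. x \<in> topspace K \<Longrightarrow> \<exists>z\<in>Z. \<forall>y\<in>topspace L. \<bar>f (x, y) - f (z, y)\<bar> \<le> \<epsilon>"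
      using finite_uniform_net_of_slices[OF K L f \<epsilon>] by metis
    have "\<bar>?A n / (real (Suc n) * 2 ^ Suc n)\<bar> \<le> card Z * M / sqrt (Suc n) + \<epsilon>" for n
    proof -
      let ?P = "Pow {..n}"
      let ?R = "\<lambda>i z. \<bar>\<Sum>s\<in>?P. rademacher i s * f (z, y s)\<bar>"
      have row: "?R i (x n i) \<le> (\<Sum>z\<in>Z. ?R i z) + 2 ^ Suc n * \<epsilon>" for i
      proof -
        obtain z where z: "z \<in> Z" "\<And>y. y \<in> topspace L \<Longrightarrow> \<bar>f (x n i, y) - f (z, y)\<bar> \<le> \<epsilon>"
          using net[OF x] by blast
        have "?R i (x n i) - ?R i z \<le> \<bar>\<Sum>s\<in>?P. rademacher i s * (f (x n i, y s) - f (z, y s))\<bar>"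
          by (simp add: right_diff_distrib sum_subtractf)
        also have "\<dots> \<le> (\<Sum>s\<in>?P. \<bar>rademacher i s * (f (x n i, y s) - f (z, y s))\<bar>)"
          by (rule sum_abs)
        also have "\<dots> \<le> (\<Sum>s\<in>?P. \<epsilon>)"
          using z(2) y by (intro sum_mono) (simp add: abs_mult)
        also have "\<dots> = 2 ^ Suc n * \<epsilon>"
          by (simp add: card_Pow)
        finally show ?thesis
          using member_le_sum[of z Z "?R i"] z(1) Z(1) by auto
      qed
      have "\<bar>?A n\<bar> \<le> (\<Sum>i\<le>n. ?R i (x n i))"
        by (rule sum_abs)
      also have "\<dots> \<le> (\<Sum>i\<le>n. (\<Sum>z\<in>Z. ?R i z) + 2 ^ Suc n * \<epsilon>)"
        by (intro sum_mono row)
      also have "\<dots> = (\<Sum>z\<in>Z. \<Sum>i\<le>n. ?R i z) + Suc n * (2 ^ Suc n * \<epsilon>)"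
        by (subst sum.swap) (simp add: sum.distrib)
      also have "\<dots> \<le> (\<Sum>z\<in>Z. M * (2 ^ Suc n * sqrt (Suc n))) + Suc n * (2 ^ Suc n * \<epsilon>)"
      proof (intro add_right_mono sum_mono)
        fix z assume "z \<in> Z"
        then have "\<bar>f (z, y s)\<bar> \<le> M" for s
          using M Z(2) y by auto
        then show "(\<Sum>i\<le>n. ?R i z) \<le> M * (2 ^ Suc n * sqrt (Suc n))"
          using sum_abs_rademacher_le[of "{..n}" "\<lambda>s. f (z, y s)" M] by simp
      qed
      finally have "\<bar>?A n\<bar> \<le> card Z * M * (2 ^ Suc n * sqrt (Suc n)) + Suc n * (2 ^ Suc n * \<epsilon>)"
        by (simp add: mult.assoc)
      then have "\<bar>?A n\<bar> / (real (Suc n) * 2 ^ Suc n)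
          \<le> (card Z * M * (2 ^ Suc n * sqrt (Suc n)) + Suc n * (2 ^ Suc n * \<epsilon>)) / (real (Suc n) * 2 ^ Suc n)"
        by (rule divide_right_mono) simp
      also have "\<dots> = card Z * M * (sqrt (Suc n) / Suc n) + \<epsilon>"
        by (simp add: add_divide_distrib del: of_nat_Suc power_Suc)
      also have "sqrt (Suc n) / Suc n = 1 / sqrt (Suc n)"
        using sqrt_divide_self_eq[of "real (Suc n)"] by (simp add: inverse_eq_divide del: of_nat_Suc)
      finally show ?thesis
        by (simp add: abs_divide)
    qed
    then show ?thesis by blast
  qed
  show ?thesis
  proof (rule LIMSEQ_I)
    fix \<epsilon> :: real assume "0 < \<epsilon>"
    then obtain C where C: "\<And>n. \<bar>?A n / (real (Suc n) * 2 ^ Suc n)\<bar> \<le> C / sqrt (Suc n) + \<epsilon> / 2"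
      using est[of "\<epsilon> / 2"] by auto
    have "filterlim (\<lambda>n. sqrt (Suc n)) at_top sequentially"
      by (rule filterlim_compose[OF sqrt_at_top])
        (rule filterlim_compose[OF filterlim_real_sequentially filterlim_Suc])
    then have "(\<lambda>n. C / sqrt (Suc n)) \<longlonglongrightarrow> 0"
      by (intro tendsto_divide_0[OF tendsto_const] filterlim_at_top_imp_at_infinity)
    then obtain n0 where n0: "\<And>n. n \<ge> n0 \<Longrightarrow> \<bar>C / sqrt (Suc n)\<bar> < \<epsilon> / 2"
      using LIMSEQ_D[of _ 0 "\<epsilon> / 2"] \<open>0 < \<epsilon>\<close> by (metis diff_zero half_gt_zero real_norm_def)
    have "norm (?A n / (real (Suc n) * 2 ^ Suc n) - 0) < \<epsilon>" if "n \<ge> n0" for n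
      using C[of n] n0[OF that] unfolding diff_zero real_norm_def by linarith
    then show "\<exists>n0. \<forall>n\<ge>n0. norm (?A n / (real (Suc n) * 2 ^ Suc n) - 0) < \<epsilon>" by blast
  qed
qed

section \<open>Disjoint bump functions\<close>

text \<open>Two points of \<open>W\<close> have disjoint neighbourhoods \<open>A\<close> and \<open>B\<close> in \<open>W\<close>. Either the complement of
  the closure of \<open>A\<close> is infinite in \<open>W\<close>, or \<open>B\<close> is finite; then the points of \<open>B\<close> are isolated,
  and one of them can be split off.\<close>

lemma open_splitting_of_infinite_open_set:
  assumes X: "Hausdorff_space X" and W: "openin X W" "infinite W"
  shows "\<exists>p U W'. openin X U \<and> p \<in> U \<and> U \<subseteq> W \<and> openin X W' \<and> W' \<subseteq> W \<and> infinite W' \<and> U \<inter> W' = {}"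
proof -
  obtain a where a: "a \<in> W" using W(2) by fastforce
  obtain b where b: "b \<in> W" "b \<noteq> a" using W(2) infinite_imp_nonempty[of "W - {a}"] by auto
  have "a \<in> topspace X" "b \<in> topspace X" using a b W(1) openin_subset by blast+
  then obtain A' B' where "openin X A'" "openin X B'" "a \<in> A'" "b \<in> B'" "disjnt A' B'"
    using X b(2) unfolding Hausdorff_space_def by metis
  then obtain A B where AB: "openin X A" "openin X B" "a \<in> A" "b \<in> B" "A \<inter> B = {}" "A \<subseteq> W" "B \<subseteq> W"
    using that[of "A' \<inter> W" "B' \<inter> W"] a b W(1) by (auto simp: disjnt_iff openin_Int)
  show ?thesis
  proof (cases "infinite (W - X closure_of A)")
    case True
    moreover have "A \<subseteq> X closure_of A"
      by (simp add: closure_of_subset AB openin_subset)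
    ultimately show ?thesis
      using AB W(1) by (intro exI[of _ a] exI[of _ A] exI[of _ "W - X closure_of A"])
        (auto simp: openin_diff)
  next
    case False
    have "B \<inter> X closure_of A = {}"
      using AB openin_Int_closure_of_eq_empty[of X B A] by auto
    then have "B \<subseteq> W - X closure_of A"
      using AB(7) by blast
    then have "finite B"
      using False finite_subset by blast
    have sing: "closedin X (B - {b})"
    proof (rule closedin_Hausdorff_finite[OF X])
      show "B - {b} \<subseteq> topspace X" using AB openin_subset by blast
    qed (use \<open>finite B\<close> in simp)
    have "{b} = B - (B - {b})" using AB by auto
    then have "openin X {b}" using AB sing by (metis openin_diff)
    moreover have "openin X (W - {b})"
      using W(1) X \<open>b \<in> topspace X\<close> by (simp add: openin_diff closedin_Hausdorff_singleton)
    ultimately show ?thesis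
      using b W(2) by (intro exI[of _ b] exI[of _ "{b}"] exI[of _ "W - {b}"]) auto
  qed
qed

text \<open>Split off an open set repeatedly, keeping an infinite open remainder \<open>W\<close> for the next step.\<close>

lemma disjoint_open_sequence:
  assumes X: "Hausdorff_space X" and "infinite (topspace X)"
  obtains p U where "\<And>n::nat. openin X (U n)" "\<And>n. p n \<in> U n" "\<And>m n. m \<noteq> n \<Longrightarrow> U m \<inter> U n = {}"
proof -
  define P where "P t \<longleftrightarrow> (case t of (p, U, W) \<Rightarrow>
    openin X W \<and> infinite W \<and> openin X U \<and> p \<in> U \<and> U \<inter> W = {})" for t
  define Q where "Q t t' \<longleftrightarrow> (case t of (p, U, W) \<Rightarrow> case t' of (p', U', W') \<Rightarrow> U' \<subseteq> W \<and> W' \<subseteq> W)"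
    for t t' :: "'a \<times> 'a set \<times> 'a set"
  have "\<exists>t. P t"
    using open_splitting_of_infinite_open_set[OF X openin_topspace assms(2)]
    unfolding P_def by fastforce
  moreover have "\<exists>t'. P t' \<and> Q t t'" if "P t" for t
  proof -
    obtain p U W where t: "t = (p, U, W)" by (cases t)
    with that have "openin X W" "infinite W" by (auto simp: P_def)
    from open_splitting_of_infinite_open_set[OF X this] show ?thesis
      unfolding t P_def Q_def by fastforce
  qed
  ultimately have "\<exists>t. \<forall>n::nat. P (t n) \<and> Q (t n) (t (Suc n))"
    by (intro dependent_nat_choice) auto
  then obtain t where t: "\<And>n. P (t n)" "\<And>n::nat. Q (t n) (t (Suc n))"
    by blast
  define p where "p n = fst (t n)" for n
  define U where "U n = fst (snd (t n))" for n
  define W where "W n = snd (snd (t n))" for n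
  have P: "openin X (U n)" "p n \<in> U n" "U n \<inter> W n = {}"
    and Q: "U (Suc n) \<subseteq> W n" "W (Suc n) \<subseteq> W n" for n
    using t(1)[of n] t(2)[of n] by (auto simp: p_def U_def W_def P_def Q_def split: prod.splits)
  have UW: "U n \<subseteq> W m" if "m < n" for m n
  proof -
    obtain k where "n = Suc k" "m \<le> k" using \<open>m < n\<close> by (cases n) auto
    then show ?thesis using Q(1)[of k] lift_Suc_antimono_le[of W m k] Q(2) by blast
  qed
  have "U m \<inter> U n = {}" if "m \<noteq> n" for m n
    using that UW P(3) by (cases m n rule: linorder_cases) blast+
  then show thesis using that P by blast
qed

lemma disjoint_bump_functions:
  assumes X: "compact_space X" "Hausdorff_space X" and "infinite (topspace X)"
  obtains p and u :: "nat \<Rightarrow> 'a \<Rightarrow> real"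
  where "\<And>n. p n \<in> topspace X" "\<And>n. continuous_map X euclideanreal (u n)" "\<And>n. u n (p n) = 1"
    "\<And>n x. x \<in> topspace X \<Longrightarrow> 0 \<le> u n x \<and> u n x \<le> 1"
    "\<And>m n x. x \<in> topspace X \<Longrightarrow> m \<noteq> n \<Longrightarrow> u m x = 0 \<or> u n x = 0"
proof -
  obtain p U where U: "\<And>n::nat. openin X (U n)" "\<And>n. p n \<in> U n"
    and disj: "\<And>m n. m \<noteq> n \<Longrightarrow> U m \<inter> U n = {}"
    using disjoint_open_sequence[OF X(2) assms(3)] by metis
  have p: "p n \<in> topspace X" for n using U openin_subset by blast
  have "completely_regular_space X"
    using X by (simp add: compact_Hausdorff_or_regular_imp_normal_space
        normal_imp_completely_regular_space_gen)
  then have "\<exists>f. continuous_map X (top_of_set {0..1::real}) f \<and> f (p n) = 0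
      \<and> f ` (topspace X - U n) \<subseteq> {1}" for n
    unfolding completely_regular_space_def using U p by blast
  then obtain f where f: "\<And>n. continuous_map X (top_of_set {0..1::real}) (f n)"
    "\<And>n. f n (p n) = 0" "\<And>n x. x \<in> topspace X - U n \<Longrightarrow> f n x = 1"
    by (metis image_subset_iff singletonD)
  show thesis
  proof (rule that[of p "\<lambda>n x. 1 - f n x"])
    show "continuous_map X euclideanreal (\<lambda>x. 1 - f n x)" for n
      using f(1)[of n] by (intro continuous_map_diff) (auto simp: continuous_map_in_subtopology)
    show "0 \<le> 1 - f n x \<and> 1 - f n x \<le> 1" if "x \<in> topspace X" for n x
      using f(1)[of n] that by (auto simp: continuous_map_in_subtopology)
    show "1 - f m x = 0 \<or> 1 - f n x = 0" if "x \<in> topspace X" "m \<noteq> n" for m n x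
      using f(3)[of x m] f(3)[of x n] disj[OF that(2)] that(1) by auto
  qed (use p f(2) in auto)
qed

text \<open>At any point at most one of several disjointly supported bump functions is nonzero.\<close>

lemma sum_disjoint_le_1:
  fixes u :: "'j \<Rightarrow> real"
  assumes "finite J" "\<And>j. j \<in> J \<Longrightarrow> 0 \<le> u j \<and> u j \<le> 1"
    and "\<And>i j. i \<in> J \<Longrightarrow> j \<in> J \<Longrightarrow> i \<noteq> j \<Longrightarrow> u i = 0 \<or> u j = 0"
  shows "sum u J \<le> 1"
proof (cases "\<exists>k\<in>J. u k \<noteq> 0")
  case True
  then obtain k where "k \<in> J" "u k \<noteq> 0" by blast
  then have "sum u J = (\<Sum>j\<in>J. if j = k then u k else 0)"
    using assms(3) by (intro sum.cong) auto
  then show ?thesis using \<open>k \<in> J\<close> assms by simp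
qed simp

section \<open>Products of two infinite compact spaces\<close>

theorem corollary11p5:
  fixes K :: "'a topology" and L :: "'b topology"
  assumes "compact_space K" and "Hausdorff_space K" and "infinite (topspace K)"
    and "compact_space L" and "Hausdorff_space L" and "infinite (topspace L)"
  shows "admits_quotient (Cp (prod_topology K L)) c0p"
proof -
  obtain p and u :: "nat \<Rightarrow> 'a \<Rightarrow> real"
    where p: "\<And>n. p n \<in> topspace K" and u_cont: "\<And>n. continuous_map K euclideanreal (u n)"
      and u_p: "\<And>n. u n (p n) = 1"
      and u_01: "\<And>n x. x \<in> topspace K \<Longrightarrow> 0 \<le> u n x \<and> u n x \<le> 1"
      and u_disj: "\<And>m n x. x \<in> topspace K \<Longrightarrow> m \<noteq> n \<Longrightarrow> u m x = 0 \<or> u n x = 0"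
    using disjoint_bump_functions[OF assms(1-3)] by metis
  obtain q and v :: "nat \<Rightarrow> 'b \<Rightarrow> real"
    where q: "\<And>n. q n \<in> topspace L" and v_cont: "\<And>n. continuous_map L euclideanreal (v n)"
      and v_q: "\<And>n. v n (q n) = 1"
      and v_01: "\<And>n x. x \<in> topspace L \<Longrightarrow> 0 \<le> v n x \<and> v n x \<le> 1"
      and v_disj: "\<And>m n x. x \<in> topspace L \<Longrightarrow> m \<noteq> n \<Longrightarrow> v m x = 0 \<or> v n x = 0"
    using disjoint_bump_functions[OF assms(4-6)] by metis
  \<comment> \<open>The index \<open>n\<close> of the points of \<open>K\<close> keeps different \<open>\<phi> n\<close> disjoint, so the points of \<open>L\<close> can
      be shared by all \<open>n\<close>.\<close>
  define x where "x n i = p (prod_encode (n, i))" for n i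
  define a where "a n i = u (prod_encode (n, i))" for n i
  define y where "y s = q (set_encode s)" for s
  define b where "b s = v (set_encode s)" for s
  have x: "x n i \<in> topspace K" and y: "y s \<in> topspace L" for n i s
    by (simp_all add: x_def y_def p q)
  have a_01: "0 \<le> a n i t" "a n i t \<le> 1" if "t \<in> topspace K" for n i t
    using u_01 that by (auto simp: a_def)
  have b_01: "0 \<le> b s t" "b s t \<le> 1" if "t \<in> topspace L" for s t
    using v_01 that by (auto simp: b_def)
  have a_disj: "a n i t = 0 \<or> a m j t = 0" if "t \<in> topspace K" "(n, i) \<noteq> (m, j)" for n i m j t
    using u_disj[OF that(1), of "prod_encode (n, i)" "prod_encode (m, j)"] that(2)
    by (auto simp: a_def)
  have b_disj: "b s t = 0 \<or> b s' t = 0"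
    if "t \<in> topspace L" "finite s" "finite s'" "s \<noteq> s'" for s s' t
    using v_disj[OF that(1), of "set_encode s" "set_encode s'"] that(2-4)
    by (auto simp: b_def set_encode_eq)
  have a_x: "a m j (x n i) = (if (n, i) = (m, j) then 1 else 0)" for m n i j
    using a_disj[OF x, of n i m j n i] by (auto simp: a_def x_def u_p)
  have b_y: "b s' (y s) = (if s = s' then 1 else 0)" if "finite s" "finite s'" for s s'
    using b_disj[OF y that, of s] by (auto simp: b_def y_def v_q)
  define \<phi> where
    "\<phi> n = (\<lambda>(t, r). \<Sum>i\<le>n. \<Sum>s\<in>Pow {..n}. rademacher i s * (a n i t * b s r))" for n
  have \<phi>_at: "\<phi> n (x n i, y s) = rademacher i s" if "i \<le> n" "s \<in> Pow {..n}" for n i s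
  proof -
    have fin: "finite s'" if "s' \<in> Pow {..n}" for s'
      using that finite_subset by auto
    have "\<phi> n (x n i, y s)
        = (\<Sum>i'\<le>n. \<Sum>s'\<in>Pow {..n}. if s' = s then (if i' = i then rademacher i s else 0) else 0)"
      unfolding \<phi>_def prod.case
      using that fin by (intro sum.cong refl) (auto simp: a_x b_y)
    then show ?thesis using that by simp
  qed
  let ?J = "\<lambda>n. {..n} \<times> Pow {..n}"
  let ?z = "\<lambda>n (i, s). (x n i, y s)"
  let ?w = "\<lambda>n (i, s). rademacher i s / (real (Suc n) * 2 ^ Suc n)"
  show ?thesis
  proof (rule Cp_admits_quotient_c0p[where J = ?J and z = ?z and w = ?w and \<phi> = \<phi>])
    show "?z n j \<in> topspace (prod_topology K L)" for n j
      using x y by (auto split: prod.splits)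
    show "(\<lambda>n. \<Sum>j\<in>?J n. ?w n j * f (?z n j)) \<longlonglongrightarrow> 0"
      if "continuous_map (prod_topology K L) euclideanreal f" for f
      using rademacher_averages_tendsto_0[OF assms(1,4) that x y]
      by (simp add: sum.cartesian_product sum_divide_distrib case_prod_unfold)
    show "continuous_map (prod_topology K L) euclideanreal (\<phi> n)" for n
    proof -
      have "continuous_map (prod_topology K L) euclideanreal (\<lambda>r. a n i (fst r))"
        "continuous_map (prod_topology K L) euclideanreal (\<lambda>r. b s (snd r))" for i s
        unfolding a_def b_def
        using continuous_map_compose[OF continuous_map_fst u_cont]
          continuous_map_compose[OF continuous_map_snd v_cont] by (simp_all add: o_def)
      then show ?thesis
        unfolding \<phi>_def case_prod_unfold
        by (intro continuous_map_sum continuous_map_real_mult_left continuous_map_real_mult) auto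
    qed
    show "\<bar>\<phi> n r\<bar> \<le> 1" if "r \<in> topspace (prod_topology K L)" for n r
    proof -
      obtain t t' where r: "r = (t, t')" "t \<in> topspace K" "t' \<in> topspace L"
        using \<open>r \<in> topspace (prod_topology K L)\<close> by auto
      \<comment> \<open>Without the signs the double sum factors into two sums of disjoint bumps.\<close>
      have "\<bar>\<phi> n r\<bar> \<le> (\<Sum>i\<le>n. \<Sum>s\<in>Pow {..n}. \<bar>rademacher i s * (a n i t * b s t')\<bar>)"
        unfolding \<phi>_def r(1) prod.case by (intro order_trans[OF sum_abs] sum_mono sum_abs)
      also have "\<dots> = (\<Sum>i\<le>n. a n i t) * (\<Sum>s\<in>Pow {..n}. b s t')"
        using r by (simp add: abs_mult a_01 b_01 sum_product)
      also have "\<dots> \<le> 1"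
      proof (intro mult_le_one sum_disjoint_le_1 sum_nonneg)
        fix s s' assume "s \<in> Pow {..n}" "s' \<in> Pow {..n}" "s \<noteq> s'"
        then show "b s t' = 0 \<or> b s' t' = 0"
          using b_disj[OF r(3)] by (meson PowD finite_atMost finite_subset)
      qed (use r a_01 b_01 a_disj in auto)
      finally show ?thesis .
    qed
    show "\<phi> m r = 0 \<or> \<phi> n r = 0" if r_in: "r \<in> topspace (prod_topology K L)" and "m \<noteq> n" for m n r
    proof (rule ccontr)
      obtain t t' where r: "r = (t, t')" "t \<in> topspace K" using r_in by auto
      assume "\<not> (\<phi> m r = 0 \<or> \<phi> n r = 0)"
      moreover have "\<exists>i. a k i t \<noteq> 0" if "\<phi> k r \<noteq> 0" for k
        by (rule ccontr) (use that in \<open>simp add: \<phi>_def r(1)\<close>)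
      ultimately obtain i j where "a m i t \<noteq> 0" "a n j t \<noteq> 0" by blast
      then show False using a_disj[OF r(2), of m i n j] \<open>m \<noteq> n\<close> by simp
    qed
    show "(\<Sum>j\<in>?J n. ?w n j * \<phi> n (?z n j)) = 1" for n
    proof -
      have "(\<Sum>j\<in>?J n. ?w n j * \<phi> n (?z n j)) = (\<Sum>j\<in>?J n. 1 / (real (Suc n) * 2 ^ Suc n))"
        by (intro sum.cong) (auto simp: \<phi>_at)
      also have "\<dots> = 1"
        by (simp add: card_Pow card_cartesian_product del: of_nat_Suc power_Suc mult_Suc)
      finally show ?thesis .
    qed
    show "\<phi> m (?z n j) = 0" if "j \<in> ?J n" "m \<noteq> n" for m n j
      using that by (auto simp: \<phi>_def a_x)
  qed
qed

end
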